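(* Let $A\subseteq \{0,1\}^n$. Then $\mathrm{xc}(\mathrm{conv}(A))\leq O(2^n/n)$. Moreover, assume that for every bipartite graph $G$ on $2m$ vertices with the two parts of equal size, $\mathrm{xc}(P_G)\leq O(m^c)$, where $c\leq 2$ is an absolute constant. Then $\mathrm{xc}(\mathrm{conv}(A))\leq O(2^{cn/2})$.
   Context: A polytope in $\mathbb{R}^n$ is the convex hull of a finite set of points. The extension complexity $\mathrm{xc}(P)$ of a polytope $P\subseteq\mathbb{R}^n$ is the smallest $k$ such that there exist a polytope $Q\subseteq \mathbb{R}^m$ (for some $m$) with $k$ facets and an affine map $\pi:\mathbb{R}^m\to\mathbb{R}^n$ with $P=\pi(Q)$. $\mathrm{conv}$ denotes convex hull, with $\{0,1\}^n$ viewed as a subset of $\mathbb{R}^n$. For a simple undirected graph $G$ with vertex set $[N]=\{1,\dots,N\}$, $P_G\subseteq\mathbb{R}^N$ is the convex hull of the characteristic vectors of its edges, $P_G=\mathrm{conv}(\{e_i+e_j : i\neq j \text{ adjacent in } G\})$, where $e_i$ is the $i$-th standard unit vector. Constants hidden in $O(\cdot)$ are uniform: they do not depend on $n$, $A$, $m$ or $G$ (in the second part the constant in the conclusion may depend on the constant in the assumption and on $c$). *)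

theory Defs
  imports "HOL-Analysis.Analysis" "HOL-Analysis.Finite_Function_Topology"
begin

text \<open>
  The dimension of the ambient space is quantified inside the statement, so it cannot be a type.
  The space \<open>\<real>\<^sup>n\<close> is the subspace of the finitely supported functions \<open>(nat, real) poly_mapping\<close> (an instance
  of class \<^class>\<open>real_vector\<close>) with support in \<open>{1..n}\<close>; the general notions \<^const>\<open>hull\<close>,
  \<^const>\<open>polytope\<close>, \<^const>\<open>face_of\<close> and \<^const>\<open>linear\<close> apply there.
\<close>

type_synonym rvec = "(nat, real) poly_mapping"

definition Rn :: "nat \<Rightarrow> rvec set" where
  "Rn n = {x. Poly_Mapping.keys x \<subseteq> {1..n}}"

definition unit_vec :: "nat \<Rightarrow> rvec" where
  "unit_vec i = Poly_Mapping.single i 1"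

definition zero_one_vectors :: "nat \<Rightarrow> rvec set" where
  "zero_one_vectors n = {x \<in> Rn n. \<forall>i\<in>{1..n}. Poly_Mapping.lookup x i \<in> {0, 1}}"

text \<open>
  \<^const>\<open>aff_dim\<close> and \<^const>\<open>facet_of\<close> are restricted to class \<^class>\<open>euclidean_space\<close>. The two
  definitions below repeat theirs for class \<^class>\<open>real_vector\<close>. They are meaningful for sets of
  finite affine dimension, in particular for subsets of \<open>Rn m\<close>.
\<close>

definition affine_dim :: "'a::real_vector set \<Rightarrow> int" where
  "affine_dim V =
    (SOME d :: int. \<exists>B. affine hull B = affine hull V \<and> \<not> affine_dependent B \<and> of_nat (card B) = d + 1)"

definition is_facet_of :: "'a::real_vector set \<Rightarrow> 'a set \<Rightarrow> bool" where
  "is_facet_of F S \<longleftrightarrow> F face_of S \<and> F \<noteq> {} \<and> affine_dim F = affine_dim S - 1"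

lemma affine_dim_eq_aff_dim: "affine_dim V = aff_dim (V :: 'a::euclidean_space set)"
  unfolding affine_dim_def aff_dim_def ..

lemma is_facet_of_iff_facet_of: "is_facet_of F S \<longleftrightarrow> F facet_of (S :: 'a::euclidean_space set)"
  unfolding is_facet_of_def facet_of_def affine_dim_eq_aff_dim ..

text \<open>
  Every affine map \<open>\<real>\<^sup>m \<rightarrow> \<real>\<^sup>n\<close> is the restriction to \<open>Rn m\<close> of an affine map on the whole of
  \<^typ>\<open>rvec\<close>, since linear maps extend from subspaces.
\<close>

definition affine_map_between :: "nat \<Rightarrow> nat \<Rightarrow> (rvec \<Rightarrow> rvec) \<Rightarrow> bool" where
  "affine_map_between m n \<pi> \<longleftrightarrow> (\<exists>L b. linear L \<and> \<pi> = (\<lambda>x. L x + b)) \<and> \<pi> ` Rn m \<subseteq> Rn n"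

definition has_extension :: "nat \<Rightarrow> rvec set \<Rightarrow> nat \<Rightarrow> bool" where
  "has_extension n P k \<longleftrightarrow>
    (\<exists>m Q \<pi>. polytope Q \<and> Q \<subseteq> Rn m \<and> finite {F. is_facet_of F Q} \<and> card {F. is_facet_of F Q} = k \<and>
       affine_map_between m n \<pi> \<and> P = \<pi> ` Q)"

definition xc :: "nat \<Rightarrow> rvec set \<Rightarrow> nat" where
  "xc n P = (LEAST k. has_extension n P k)"

definition simple_graph :: "nat \<Rightarrow> nat set set \<Rightarrow> bool" where
  "simple_graph N E \<longleftrightarrow> (\<forall>e\<in>E. e \<subseteq> {1..N} \<and> card e = 2)"

definition balanced_bipartite_graph :: "nat \<Rightarrow> nat set set \<Rightarrow> bool" where
  "balanced_bipartite_graph m E \<longleftrightarrow> simple_graph (2 * m) E \<and>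
    (\<exists>U W. U \<union> W = {1..2 * m} \<and> U \<inter> W = {} \<and> card U = m \<and> card W = m \<and>
       (\<forall>e\<in>E. \<exists>u\<in>U. \<exists>w\<in>W. e = {u, w}))"

definition edge_polytope :: "nat set set \<Rightarrow> rvec set" where
  "edge_polytope E = convex hull {unit_vec i + unit_vec j | i j. i \<noteq> j \<and> {i, j} \<in> E}"

end

theory Submission
  imports Defs
begin

text \<open>
  Split the coordinates into a low and a high block, so that \<open>A\<close> becomes the edge set of a bipartite
  graph between low and high 0/1 vectors; \<open>conv A\<close> is the image of the edge polytope under
  \<open>e\<^sub>y \<mapsto> y\<close>. For blocks of equal size this gives the second bound.

  For the first bound let the high block have about \<open>log n\<close> coordinates and group the low vectors \<open>y\<close>
  by their neighbourhood \<open>S = {z. y + z \<in> A}\<close>. This partitions the edges into bicliques, one for each of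
  the few sets \<open>S\<close>. Giving every biclique its own copy of the vertices in \<open>S\<close> makes them disjoint, and
  the edge polytope of a disjoint union of bicliques consists of the nonnegative vectors in an
  affine space: the two sides of each biclique carry the same weight and the total is 1. Such a
  polytope has at most one facet per coordinate.
\<close>

section \<open>Affine dimension inside a finitely spanned subspace\<close>

text \<open>Subtracting \<open>a\<close> turns affine independence into linear independence, and the
  span of \<open>T\<close> bounds the size of a linearly independent set. The right-hand side sees
  \<open>C\<close> only through its affine hull, which is what allows bases to be compared.\<close>

lemma affine_independent_finite_card:
  fixes C T :: "'a::real_vector set"
  assumes T: "finite T" "C \<subseteq> span T" and C: "\<not> affine_dependent C" "a \<in> C"
  shows "finite C \<and> card C = real_vector.dim ((\<lambda>x. -a + x) ` (affine hull C)) + 1"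
proof -
  let ?D = "(\<lambda>x. -a + x) ` (C - {a})"
  have ind: "independent ?D"
    using C affine_dependent_iff_dependent2 by blast
  have sp: "(\<lambda>x. -a + x) ` (affine hull C) = span ?D"
    unfolding affine_hull_span2[OF C(2)] by (auto simp: image_image)
  have "?D \<subseteq> span T"
  proof
    fix y assume "y \<in> ?D"
    then obtain x where "x \<in> C" "y = -a + x" by blast
    then show "y \<in> span T"
      using T(2) C(2) span_diff[of x T a] by auto
  qed
  then have "finite ?D"
    using real_vector.independent_span_bound[OF T(1) ind] by simp
  then have "finite (C - {a})"
    by (rule finite_imageD) (simp add: inj_on_def)
  moreover have "card ?D = card (C - {a})"
    by (intro card_image) (simp add: inj_on_def)
  moreover have "real_vector.dim (span ?D) = card ?D"
    using ind by (rule real_vector.dim_span_eq_card_independent)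
  ultimately show ?thesis
    using C(2) card_Suc_Diff1[of C a] unfolding sp by simp
qed

text \<open>Equal hulls put \<open>C\<close> into \<open>span T\<close> as well, so both
  cardinalities are one plus the dimension of the direction space of the common hull.\<close>

lemma affine_independent_card_unique:
  fixes B C T :: "'a::real_vector set"
  assumes T: "finite T" "B \<subseteq> span T"
    and "\<not> affine_dependent B" "\<not> affine_dependent C" and hull: "affine hull B = affine hull C"
  shows "finite C \<and> card B = card C"
proof (cases "C = {}")
  case True
  then show ?thesis using hull by simp
next
  case False
  then obtain a b where ab: "a \<in> C" "b \<in> B"
    using hull affine_hull_eq_empty[of B] affine_hull_eq_empty[of C] by auto
  have mem: "a \<in> affine hull B" "b \<in> affine hull B"
    using hull_inc[of a C affine] hull_inc[of b B affine] ab hull by simp_all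
  have "affine hull B \<subseteq> span T"
    by (intro hull_minimal T(2) subspace_imp_affine subspace_span)
  then have CT: "C \<subseteq> span T"
    using hull_subset[of C affine] hull by auto
  \<comment> \<open>The direction space of an affine set does not depend on the base point; by
    symmetry one inclusion is enough.\<close>
  have shift: "(\<lambda>x. -u + x) ` (affine hull B) \<subseteq> (\<lambda>x. -v + x) ` (affine hull B)"
    if "u \<in> affine hull B" "v \<in> affine hull B" for u v
  proof clarify
    fix x assume "x \<in> affine hull B"
    then have "x + 1 *\<^sub>R (v - u) \<in> affine hull B"
      using that by (intro mem_affine_3_minus) auto
    moreover have "-u + x = -v + (x + 1 *\<^sub>R (v - u))" by simp
    ultimately show "-u + x \<in> (\<lambda>x. -v + x) ` (affine hull B)" by blast
  qed
  have "(\<lambda>x. -a + x) ` (affine hull B) = (\<lambda>x. -b + x) ` (affine hull B)"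
    by (intro equalityI shift mem)
  then show ?thesis
    using affine_independent_finite_card[OF T(1) CT assms(4) ab(1)]
      affine_independent_finite_card[OF T assms(3) ab(2)] hull by simp
qed

text \<open>All affine bases have the same size, so the choice operator in \<open>affine_dim\<close>
  has only one candidate.\<close>

lemma affine_dim_eq_card:
  fixes B T :: "'a::real_vector set"
  assumes T: "finite T" "B \<subseteq> span T"
    and B: "affine hull B = affine hull V" "\<not> affine_dependent B"
  shows "affine_dim V = int (card B) - 1"
  unfolding affine_dim_def
proof (rule some_equality)
  show "\<exists>B'. affine hull B' = affine hull V \<and> \<not> affine_dependent B' \<and>
      of_nat (card B') = int (card B) - 1 + 1"
    using B by auto
next
  fix d :: int
  assume "\<exists>B'. affine hull B' = affine hull V \<and> \<not> affine_dependent B' \<and> of_nat (card B') = d + 1"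
  then obtain C where "affine hull B = affine hull C" "\<not> affine_dependent C" "int (card C) = d + 1"
    using B(1) by auto
  then show "d = int (card B) - 1"
    using affine_independent_card_unique[OF T B(2)] by simp
qed

text \<open>An affine basis of \<open>V\<close> extends to one of \<open>W\<close>, and properly so
  because the hulls differ.\<close>

lemma affine_dim_less:
  fixes V W T :: "'a::real_vector set"
  assumes T: "finite T" "W \<subseteq> span T" and "V \<subseteq> W" "affine hull V \<noteq> affine hull W"
  shows "affine_dim V < affine_dim W"
proof -
  obtain B where B: "B \<subseteq> V" "\<not> affine_dependent B" "affine hull B = affine hull V"
    using affine_basis_exists[of V] by auto
  then have "B \<subseteq> W" using assms(3) by blast
  then obtain C where C: "\<not> affine_dependent C" "B \<subseteq> C" "C \<subseteq> W" "affine hull C = affine hull W"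
    using extend_to_affine_basis[OF B(2)] by blast
  have spans: "B \<subseteq> span T" "C \<subseteq> span T"
    using T(2) \<open>B \<subseteq> W\<close> C(3) by auto
  have "B \<noteq> C"
    using B(3) C(4) assms(4) by auto
  then have "card B < card C"
    using C affine_independent_card_unique[OF T(1) spans(2) C(1) C(1)] by (intro psubset_card_mono) auto
  then show ?thesis
    using affine_dim_eq_card[OF T(1) spans(1) B(3,2)] affine_dim_eq_card[OF T(1) spans(2) C(4,1)]
    by simp
qed

section \<open>Coordinates in \<open>Rn\<close>\<close>

lemma lookup_scaleR [simp]: "Poly_Mapping.lookup (r *\<^sub>R x) i = r *\<^sub>R Poly_Mapping.lookup x i"
proof -
  have "finite {i. r *\<^sub>R Poly_Mapping.lookup x i \<noteq> 0}"
    by (rule finite_subset[OF _ finite_lookup[of x]]) auto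
  then show ?thesis by (simp add: scaleR_poly_mapping_def)
qed

lemma mem_Rn_iff: "x \<in> Rn N \<longleftrightarrow> (\<forall>i. i \<notin> {1..N} \<longrightarrow> Poly_Mapping.lookup x i = 0)"
  unfolding Rn_def by (auto simp: in_keys_iff)

lemma subspace_Rn: "subspace (Rn N)"
  by (auto simp: subspace_def mem_Rn_iff lookup_add)

lemma lookup_unit_vec: "Poly_Mapping.lookup (unit_vec i) j = (if i = j then 1 else 0)"
  by (simp add: unit_vec_def lookup_single)

lemma unit_vec_in_Rn [simp]: "unit_vec i \<in> Rn N \<longleftrightarrow> i \<in> {1..N}"
  by (auto simp: mem_Rn_iff lookup_unit_vec)

text \<open>Supplies the finite spanning set that the dimension lemmas ask for.\<close>

lemma Rn_eq_span: "Rn N = span (unit_vec ` {1..N})"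
proof
  show "span (unit_vec ` {1..N}) \<subseteq> Rn N"
    by (intro span_minimal subspace_Rn) auto
  show "Rn N \<subseteq> span (unit_vec ` {1..N})"
  proof
    fix x assume x: "x \<in> Rn N"
    have "x = (\<Sum>i\<in>{1..N}. Poly_Mapping.lookup x i *\<^sub>R unit_vec i)"
      by (rule poly_mapping_eqI)
        (use x in \<open>auto simp: mem_Rn_iff lookup_sum lookup_unit_vec if_distrib cong: if_cong\<close>)
    also have "\<dots> \<in> span (unit_vec ` {1..N})"
      by (intro span_sum span_scale span_base) auto
    finally show "x \<in> span (unit_vec ` {1..N})" .
  qed
qed

section \<open>Faces and facets of nonnegative sections\<close>

definition vanishing :: "nat set \<Rightarrow> rvec set" where
  "vanishing Z = {x. \<forall>i\<in>Z. Poly_Mapping.lookup x i = 0}"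

lemma subspace_vanishing: "subspace (vanishing Z)"
  by (auto simp: subspace_def vanishing_def lookup_add)

text \<open>For affine \<open>M\<close> this is a polyhedron in standard form: the only inequalities
  are the signs of the coordinates.\<close>

definition nonneg_section :: "nat \<Rightarrow> rvec set \<Rightarrow> rvec set" where
  "nonneg_section N M = {x \<in> Rn N \<inter> M. \<forall>i. 0 \<le> Poly_Mapping.lookup x i}"

text \<open>
  Let \<open>p\<close> be a point of the face \<open>F\<close> with the largest possible support. A point \<open>q\<close> of the section supported
  inside the support of \<open>p\<close> lies in \<open>F\<close>, because the segment from \<open>q\<close> to \<open>p\<close> can be prolonged beyond \<open>p\<close>.
\<close>

lemma face_of_nonneg_section:
  assumes M: "affine M" and F: "F face_of nonneg_section N M" "F \<noteq> {}"
  shows "\<exists>Z\<subseteq>{1..N}. F = nonneg_section N M \<inter> vanishing Z"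
proof -
  define I where "I = {i \<in> {1..N}. \<exists>x\<in>F. Poly_Mapping.lookup x i \<noteq> 0}"
  let ?Q = "nonneg_section N M"
  have FQ: "F \<subseteq> ?Q" and Fconv: "convex F"
    using F(1) by (auto simp: face_of_def)
  have nonneg: "0 \<le> Poly_Mapping.lookup x i" if "x \<in> ?Q" for x i
    using that by (simp add: nonneg_section_def)
  have "finite I" by (simp add: I_def)
  have "\<exists>p\<in>F. \<forall>i\<in>J. 0 < Poly_Mapping.lookup p i" if "finite J" "J \<subseteq> I" for J
    using that
  proof (induction J)
    case empty
    then show ?case using F(2) by auto
  next
    case (insert j J)
    then obtain p where p: "p \<in> F" "\<forall>i\<in>J. 0 < Poly_Mapping.lookup p i" by auto
    obtain q where q: "q \<in> F" "Poly_Mapping.lookup q j \<noteq> 0"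
      using insert.prems by (auto simp: I_def)
    \<comment> \<open>Passing to the midpoint keeps every coordinate positive that is positive at
      \<open>p\<close> or at \<open>q\<close>.\<close>
    have "(1/2) *\<^sub>R p + (1/2) *\<^sub>R q \<in> F"
      using Fconv p q by (intro convexD) auto
    moreover have "0 < Poly_Mapping.lookup ((1/2) *\<^sub>R p + (1/2) *\<^sub>R q) i" if "i \<in> insert j J" for i
    proof (cases "i = j")
      case True
      have "0 < Poly_Mapping.lookup q j" "0 \<le> Poly_Mapping.lookup p j"
        using q nonneg[of q j] nonneg[of p j] p(1) FQ by auto
      then show ?thesis using True by (simp add: lookup_add)
    next
      case False
      have "0 \<le> Poly_Mapping.lookup q i"
        using q(1) FQ nonneg by blast
      then show ?thesis
        using False that p(2) by (auto simp: lookup_add intro: add_pos_nonneg)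
    qed
    ultimately show ?case by blast
  qed
  then obtain p where p: "p \<in> F" "\<forall>i\<in>I. 0 < Poly_Mapping.lookup p i"
    using \<open>finite I\<close> by blast
  have pQ: "p \<in> ?Q" using p FQ by auto
  have "q \<in> F" if q: "q \<in> ?Q" "q \<in> vanishing ({1..N} - I)" for q
  proof -
    have "\<exists>e>0. \<forall>i\<in>J. e * Poly_Mapping.lookup q i \<le> Poly_Mapping.lookup p i" if "finite J" "J \<subseteq> I" for J
      using that
    proof (induction J)
      case empty
      then show ?case by (auto intro: exI[of _ 1])
    next
      case (insert j J)
      then obtain e where e: "e > 0" "\<forall>i\<in>J. e * Poly_Mapping.lookup q i \<le> Poly_Mapping.lookup p i" by auto
      \<comment> \<open>The summand 1 keeps the denominator positive, since \<open>q\<close> may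
        vanish at \<open>j\<close>.\<close>
      define d where "d = Poly_Mapping.lookup p j / (1 + Poly_Mapping.lookup q j)"
      have pj: "0 < Poly_Mapping.lookup p j" using p insert.prems by auto
      have qn: "0 \<le> Poly_Mapping.lookup q i" for i using nonneg q(1) by blast
      have d: "0 < d" "d * Poly_Mapping.lookup q j \<le> Poly_Mapping.lookup p j"
        using pj qn[of j] by (auto simp: d_def field_simps)
      have "min d e * Poly_Mapping.lookup q i \<le> Poly_Mapping.lookup p i" if "i \<in> insert j J" for i
      proof -
        have "min d e * Poly_Mapping.lookup q i \<le> d * Poly_Mapping.lookup q i"
          "min d e * Poly_Mapping.lookup q i \<le> e * Poly_Mapping.lookup q i"
          using qn by (auto intro: mult_right_mono)
        then show ?thesis using that d(2) e(2) by (metis insert_iff order_trans)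
      qed
      then show ?case using d(1) e(1) by (intro exI[of _ "min d e"]) auto
    qed
    then obtain e where e: "e > 0" "\<forall>i\<in>I. e * Poly_Mapping.lookup q i \<le> Poly_Mapping.lookup p i"
      using \<open>finite I\<close> by blast
    \<comment> \<open>This is the point p + e(p - q) beyond \<open>p\<close>. On \<open>I\<close>
      the choice of \<open>e\<close> keeps it nonnegative; off \<open>I\<close> the point
      \<open>q\<close> vanishes.\<close>
    define r where "r = (1 + e) *\<^sub>R p + (- e) *\<^sub>R q"
    have "r \<in> Rn N"
      using pQ q(1) unfolding r_def nonneg_section_def
      by (intro subspace_add subspace_scale subspace_Rn) auto
    moreover have "r \<in> M"
      unfolding r_def using pQ q(1) by (intro mem_affine[OF M]) (auto simp: nonneg_section_def)
    moreover have lookup_r: "Poly_Mapping.lookup r i = (1 + e) * Poly_Mapping.lookup p i - e * Poly_Mapping.lookup q i" for i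
      by (simp add: r_def lookup_add lookup_minus)
    moreover have "0 \<le> Poly_Mapping.lookup r i" for i
    proof (cases "i \<in> I")
      case True
      then have "e * Poly_Mapping.lookup q i \<le> Poly_Mapping.lookup p i" "0 \<le> e * Poly_Mapping.lookup p i"
        using e nonneg[OF pQ] by auto
      then show ?thesis
        using nonneg[OF pQ, of i] by (simp add: lookup_r distrib_right)
    next
      case False
      have "Poly_Mapping.lookup q i = 0"
        using False q by (cases "i \<in> {1..N}") (auto simp: vanishing_def nonneg_section_def mem_Rn_iff)
      then show ?thesis using e(1) nonneg[OF pQ, of i] by (simp add: lookup_r)
    qed
    ultimately have "r \<in> ?Q" by (simp add: nonneg_section_def)
    show "q \<in> F"
    proof (cases "q = p")
      case False
      \<comment> \<open>Solving for \<open>p\<close> places it at parameter 1/(1 + e) between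
        \<open>q\<close> and \<open>r\<close>.\<close>
      have eq: "p = (1 - 1 / (1 + e)) *\<^sub>R q + (1 / (1 + e)) *\<^sub>R r"
      proof -
        have "(1 - t) * y + t * ((1 + e) * x - e * y) = x" if "t * (1 + e) = 1" for t x y :: real
          using that by algebra
        from this[of "1 / (1 + e)"] show ?thesis
          using e(1) by (intro poly_mapping_eqI) (simp add: lookup_add lookup_r)
      qed
      moreover have "q \<noteq> r"
        using eq False by (auto simp: algebra_simps)
      ultimately have "p \<in> open_segment q r"
        unfolding in_segment using e(1) by (intro conjI exI[of _ "1 / (1 + e)"]) auto
      then show ?thesis
        using F(1) q(1) \<open>r \<in> ?Q\<close> p(1) face_ofD by blast
    qed (use p in simp)
  qed
  moreover have "F \<subseteq> vanishing ({1..N} - I)"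
    by (auto simp: vanishing_def I_def)
  ultimately have "F = ?Q \<inter> vanishing ({1..N} - I)"
    using FQ by auto
  then show ?thesis by blast
qed

text \<open>A facet is cut out by coordinates \<open>Z\<close>, one of which, \<open>i\<close>, is
  not identically zero on the section. The face where \<open>i\<close> vanishes lies between the
  facet and the section and has smaller dimension than the section. As the facet is only one
  dimension lower, the two faces coincide.\<close>

lemma facets_nonneg_section:
  assumes M: "affine M"
  shows "{F. is_facet_of F (nonneg_section N M)} \<subseteq> (\<lambda>i. nonneg_section N M \<inter> vanishing {i}) ` {1..N}"
proof clarify
  fix F assume F: "is_facet_of F (nonneg_section N M)"
  let ?Q = "nonneg_section N M"
  obtain Z where Z: "Z \<subseteq> {1..N}" "F = ?Q \<inter> vanishing Z"
    using F face_of_nonneg_section[OF M] unfolding is_facet_of_def by blast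
  have dim: "affine_dim F = affine_dim ?Q - 1"
    using F by (simp add: is_facet_of_def)
  then have "F \<noteq> ?Q" by auto
  then obtain q i where q: "q \<in> ?Q" "i \<in> Z" "Poly_Mapping.lookup q i \<noteq> 0"
    using Z(2) by (auto simp: vanishing_def)
  define G where "G = ?Q \<inter> vanishing {i}"
  have span: "?Q \<subseteq> span (unit_vec ` {1..N})"
    unfolding Rn_eq_span[symmetric] by (auto simp: nonneg_section_def)
  have "F \<subseteq> G" "G \<subseteq> ?Q"
    using Z q(2) by (auto simp: G_def vanishing_def)
  \<comment> \<open>A subspace of vanishing coordinates contains the affine hull, so one point with
    a nonzero coordinate is enough to tell two hulls apart.\<close>
  have hull: "affine hull (?Q \<inter> vanishing Y) \<subseteq> vanishing Y" for Y
    by (intro hull_minimal subspace_imp_affine subspace_vanishing) auto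
  have "affine hull G \<noteq> affine hull ?Q"
    using hull[of "{i}"] q hull_inc[of q ?Q affine] by (auto simp: G_def vanishing_def)
  then have "affine_dim G < affine_dim ?Q"
    using span \<open>G \<subseteq> ?Q\<close> by (intro affine_dim_less) auto
  have "F = G"
  proof (rule ccontr)
    assume "F \<noteq> G"
    then obtain g where g: "g \<in> G" "g \<notin> vanishing Z"
      using \<open>F \<subseteq> G\<close> \<open>G \<subseteq> ?Q\<close> Z(2) by blast
    then have "affine hull F \<noteq> affine hull G"
      using hull[of Z] hull_inc[of g G affine] Z(2) by auto
    then have "affine_dim F < affine_dim G"
      using span \<open>F \<subseteq> G\<close> \<open>G \<subseteq> ?Q\<close> affine_dim_less[of "unit_vec ` {1..N}" G F] by auto
    then show False using \<open>affine_dim G < affine_dim ?Q\<close> dim by simp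
  qed
  then show "F \<in> (\<lambda>i. ?Q \<inter> vanishing {i}) ` {1..N}"
    using Z(1) q(2) by (auto simp: G_def)
qed

lemma convex_nonneg_section:
  assumes "convex M" shows "convex (nonneg_section N M)"
proof -
  have "convex {x :: rvec. \<forall>i. 0 \<le> Poly_Mapping.lookup x i}"
    by (auto simp: convex_def lookup_add)
  moreover have "nonneg_section N M = Rn N \<inter> M \<inter> {x. \<forall>i. 0 \<le> Poly_Mapping.lookup x i}"
    by (auto simp: nonneg_section_def)
  ultimately show ?thesis
    using assms by (simp add: convex_Int subspace_imp_convex subspace_Rn)
qed

section \<open>The edge polytope of a disjoint union of bicliques\<close>

text \<open>
  The graph has an edge between coordinates \<open>f i\<close> and \<open>g j\<close> iff the colours \<open>c i\<close> and \<open>d j\<close> agree, so the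
  bicliques are the colour classes.
\<close>

definition biclique_flow :: "'a set \<Rightarrow> ('a \<Rightarrow> nat) \<Rightarrow> ('a \<Rightarrow> 'c) \<Rightarrow> 'b set \<Rightarrow> ('b \<Rightarrow> nat) \<Rightarrow> ('b \<Rightarrow> 'c) \<Rightarrow> rvec set"
  where "biclique_flow I f c J g d =
    {z. (\<Sum>i\<in>I. Poly_Mapping.lookup z (f i)) = 1 \<and>
        (\<forall>s. (\<Sum>i | i \<in> I \<and> c i = s. Poly_Mapping.lookup z (f i)) =
             (\<Sum>j | j \<in> J \<and> d j = s. Poly_Mapping.lookup z (g j)))}"

lemma affine_biclique_flow: "affine (biclique_flow I f c J g d)"
  unfolding affine_def biclique_flow_def
  by (auto simp: lookup_add sum.distrib simp flip: sum_distrib_left)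

text \<open>The substantial inclusion is a transportation problem. Within a colour the two sides
  have equal weight, so the product of the two side weights divided by that total is a coupling with
  the required row and column sums; it gives the convex coefficients.\<close>

lemma convex_hull_biclique_vertices:
  fixes f :: "'a \<Rightarrow> nat" and g :: "'b \<Rightarrow> nat" and c :: "'a \<Rightarrow> 'c" and d :: "'b \<Rightarrow> 'c"
  assumes fin: "finite I" "finite J" and inj: "inj_on f I" "inj_on g J"
    and ran: "f ` I \<union> g ` J = {1..N}" "f ` I \<inter> g ` J = {}"
  shows "convex hull {unit_vec (f i) + unit_vec (g j) | i j. i \<in> I \<and> j \<in> J \<and> c i = d j} =
    nonneg_section N (biclique_flow I f c J g d)" (is "convex hull ?V = ?Q")
proof
  have fg: "f i \<noteq> g j" if "i \<in> I" "j \<in> J" for i j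
    using ran(2) that by blast
  show "convex hull ?V \<subseteq> ?Q"
  proof (rule hull_minimal)
    show "convex ?Q"
      by (intro convex_nonneg_section affine_imp_convex affine_biclique_flow)
    show "?V \<subseteq> ?Q"
    proof clarify
      fix i j assume ij: "i \<in> I" "j \<in> J" "c i = d j"
      let ?v = "unit_vec (f i) + unit_vec (g j)"
      have vf: "Poly_Mapping.lookup ?v (f i') = (if i' = i then 1 else 0)" if "i' \<in> I" for i'
        using ij that fg[of i' j] inj(1) by (auto simp: lookup_add lookup_unit_vec inj_on_eq_iff)
      have vg: "Poly_Mapping.lookup ?v (g j') = (if j' = j then 1 else 0)" if "j' \<in> J" for j'
        using ij that fg[of i j'] inj(2) by (auto simp: lookup_add lookup_unit_vec inj_on_eq_iff)
      have "f i \<in> {1..N}" "g j \<in> {1..N}"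
        using ij ran(1) by blast+
      then have "?v \<in> Rn N"
        by (intro subspace_add subspace_Rn) simp_all
      moreover have "?v \<in> biclique_flow I f c J g d"
        using fin ij by (auto simp: biclique_flow_def vf vg)
      ultimately show "?v \<in> ?Q"
        by (auto simp: nonneg_section_def lookup_add lookup_unit_vec)
    qed
  qed
  show "?Q \<subseteq> convex hull ?V"
  proof
    fix z assume "z \<in> ?Q"
    then have zR: "z \<in> Rn N" and nonneg: "\<And>i. 0 \<le> Poly_Mapping.lookup z i"
      and total: "(\<Sum>i\<in>I. Poly_Mapping.lookup z (f i)) = 1"
      and bal: "\<And>s. (\<Sum>i | i \<in> I \<and> c i = s. Poly_Mapping.lookup z (f i)) =
             (\<Sum>j | j \<in> J \<and> d j = s. Poly_Mapping.lookup z (g j))"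
      by (auto simp: nonneg_section_def biclique_flow_def)
    define w where "w s = (\<Sum>i | i \<in> I \<and> c i = s. Poly_Mapping.lookup z (f i))" for s
    \<comment> \<open>Division by zero yields 0. This is the right value, because all coordinates of
      a colour of weight 0 vanish.\<close>
    define u where "u i j = Poly_Mapping.lookup z (f i) * Poly_Mapping.lookup z (g j) / w (d j)" for i j
    define W where "W = Sigma I (\<lambda>i. {j \<in> J. d j = c i})"
    have w_nonneg: "0 \<le> w s" for s
      unfolding w_def by (intro sum_nonneg nonneg)
    have zero_f: "Poly_Mapping.lookup z (f i) = 0" if "i \<in> I" "w (c i) = 0" for i
      using that fin nonneg by (auto simp: w_def sum_nonneg_eq_0_iff)
    have zero_g: "Poly_Mapping.lookup z (g j) = 0" if "j \<in> J" "w (d j) = 0" for j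
      using that fin nonneg by (auto simp: w_def bal sum_nonneg_eq_0_iff)
    have row: "(\<Sum>j | j \<in> J \<and> d j = c i. u i j) = Poly_Mapping.lookup z (f i)" if "i \<in> I" for i
    proof -
      have "(\<Sum>j | j \<in> J \<and> d j = c i. u i j) =
          (\<Sum>j | j \<in> J \<and> d j = c i. Poly_Mapping.lookup z (f i) / w (c i) * Poly_Mapping.lookup z (g j))"
        by (intro sum.cong) (auto simp: u_def)
      also have "\<dots> = Poly_Mapping.lookup z (f i) / w (c i) * w (c i)"
        by (simp only: w_def bal sum_distrib_left)
      finally show ?thesis
        using zero_f[OF that] by (cases "w (c i) = 0") auto
    qed
    have col: "(\<Sum>i | i \<in> I \<and> c i = d j. u i j) = Poly_Mapping.lookup z (g j)" if "j \<in> J" for j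
    proof -
      have "(\<Sum>i | i \<in> I \<and> c i = d j. u i j) =
          (\<Sum>i | i \<in> I \<and> c i = d j. Poly_Mapping.lookup z (g j) / w (d j) * Poly_Mapping.lookup z (f i))"
        by (intro sum.cong) (auto simp: u_def)
      also have "\<dots> = Poly_Mapping.lookup z (g j) / w (d j) * w (d j)"
        by (simp only: w_def sum_distrib_left)
      finally show ?thesis
        using zero_g[OF that] by (cases "w (d j) = 0") auto
    qed
    have sum_W: "(\<Sum>(i, j)\<in>W. h i j) = (\<Sum>i\<in>I. \<Sum>j | j \<in> J \<and> d j = c i. h i j)" for h :: "'a \<Rightarrow> 'b \<Rightarrow> real"
      unfolding W_def using fin by (subst sum.Sigma) auto
    let ?v = "\<lambda>(i, j). unit_vec (f i) + unit_vec (g j)"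
    have "(\<Sum>p\<in>W. (case p of (i, j) \<Rightarrow> u i j) *\<^sub>R ?v p) \<in> convex hull ?V"
    proof (rule convex_sum)
      show "finite W" using fin by (auto simp: W_def)
      show "(\<Sum>p\<in>W. case p of (i, j) \<Rightarrow> u i j) = 1"
        unfolding sum_W using total row by simp
      fix p assume "p \<in> W"
      then obtain i j where p: "p = (i, j)" "i \<in> I" "j \<in> J" "c i = d j"
        by (auto simp: W_def)
      show "0 \<le> (case p of (i, j) \<Rightarrow> u i j)"
        by (simp add: p u_def nonneg w_nonneg)
      show "?v p \<in> convex hull ?V"
        using p by (intro hull_inc) auto
    qed simp
    moreover have "z = (\<Sum>p\<in>W. (case p of (i, j) \<Rightarrow> u i j) *\<^sub>R ?v p)"
    proof (rule poly_mapping_eqI)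
      fix k
      have R: "Poly_Mapping.lookup (\<Sum>p\<in>W. (case p of (i, j) \<Rightarrow> u i j) *\<^sub>R ?v p) k =
          (\<Sum>(i, j)\<in>W. u i j * ((if f i = k then 1 else 0) + (if g j = k then 1 else 0)))"
        unfolding lookup_sum
        by (intro sum.cong) (auto simp: lookup_add lookup_unit_vec)
      \<comment> \<open>On the \<open>f\<close> side a coordinate of the combination is a row sum of
        \<open>u\<close>, on the \<open>g\<close> side a column sum.\<close>
      consider i where "i \<in> I" "k = f i" | j where "j \<in> J" "k = g j" | "k \<notin> {1..N}"
        using ran(1) by blast
      then show "Poly_Mapping.lookup z k =
          Poly_Mapping.lookup (\<Sum>p\<in>W. (case p of (i, j) \<Rightarrow> u i j) *\<^sub>R ?v p) k"
      proof cases
        case (1 i)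
        have eq: "f i' = k \<longleftrightarrow> i' = i" if "i' \<in> I" for i'
          using 1 inj(1) that by (simp add: inj_on_eq_iff)
        have ne: "g j \<noteq> k" if "j \<in> J" for j
          using fg[OF 1(1) that] 1(2) by simp
        have "(\<Sum>(i', j)\<in>W. u i' j * ((if f i' = k then 1 else 0) + (if g j = k then 1 else 0))) =
            (\<Sum>i'\<in>I. \<Sum>j | j \<in> J \<and> d j = c i'. if i' = i then u i' j else 0)"
          unfolding sum_W using eq ne by (intro sum.cong refl) auto
        also have "\<dots> = (\<Sum>i'\<in>I. if i' = i then (\<Sum>j | j \<in> J \<and> d j = c i. u i j) else 0)"
          by (intro sum.cong) auto
        also have "\<dots> = Poly_Mapping.lookup z (f i)"
          using 1 fin row by simp
        finally show ?thesis unfolding R using 1 by simp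
      next
        case (2 j)
        have eq: "g j' = k \<longleftrightarrow> j' = j" if "j' \<in> J" for j'
          using 2 inj(2) that by (simp add: inj_on_eq_iff)
        have ne: "f i \<noteq> k" if "i \<in> I" for i
          using fg[OF that 2(1)] 2(2) by simp
        have "(\<Sum>(i, j')\<in>W. u i j' * ((if f i = k then 1 else 0) + (if g j' = k then 1 else 0))) =
            (\<Sum>i\<in>I. \<Sum>j' | j' \<in> J \<and> d j' = c i. if j' = j then u i j' else 0)"
          unfolding sum_W using eq ne by (intro sum.cong refl) auto
        also have "\<dots> = (\<Sum>i\<in>I. if c i = d j then u i j else 0)"
          using 2 fin by (intro sum.cong) auto
        also have "\<dots> = (\<Sum>i | i \<in> I \<and> c i = d j. u i j)"
          using fin by (simp add: sum.inter_filter)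
        also have "\<dots> = Poly_Mapping.lookup z (g j)"
          using 2 col by simp
        finally show ?thesis unfolding R using 2 by simp
      next
        case 3
        then have "f i \<noteq> k" "g j \<noteq> k" if "i \<in> I" "j \<in> J" for i j
          using ran(1) that by blast+
        then have "(\<Sum>(i, j)\<in>W. u i j * ((if f i = k then 1 else 0) + (if g j = k then 1 else 0))) = 0"
          by (intro sum.neutral) (auto simp: W_def)
        then show ?thesis
          unfolding R using 3 zR by (simp add: mem_Rn_iff)
      qed
    qed
    ultimately show "z \<in> convex hull ?V" by simp
  qed
qed

section \<open>Projecting bicliques to prescribed vectors\<close>

text \<open>For injective \<open>f\<close> on a finite \<open>I\<close> this is the linear map with
  \<open>unit_vec (f i)\<close> sent to \<open>a i\<close> and all other unit vectors sent to
  0.\<close>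

definition coord_map :: "'a set \<Rightarrow> ('a \<Rightarrow> nat) \<Rightarrow> ('a \<Rightarrow> rvec) \<Rightarrow> rvec \<Rightarrow> rvec" where
  "coord_map I f a z = (\<Sum>i\<in>I. Poly_Mapping.lookup z (f i) *\<^sub>R a i)"

lemma linear_coord_map: "linear (coord_map I f a)"
  by (rule linearI)
    (auto simp: coord_map_def lookup_add scaleR_add_left sum.distrib scaleR_right.sum)

lemma coord_map_unit_vec:
  assumes "finite I" "inj_on f I" "i \<in> I"
  shows "coord_map I f a (unit_vec (f i)) = a i"
proof -
  have "coord_map I f a (unit_vec (f i)) = (\<Sum>i'\<in>I. if i' = i then a i else 0)"
    unfolding coord_map_def using assms
    by (intro sum.cong) (auto simp: lookup_unit_vec inj_on_eq_iff)
  then show ?thesis using assms by simp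
qed

lemma coord_map_unit_vec_notin: "k \<notin> f ` I \<Longrightarrow> coord_map I f a (unit_vec k) = 0"
  unfolding coord_map_def by (intro sum.neutral) (auto simp: lookup_unit_vec)

lemma coord_map_in_Rn: "(\<And>i. i \<in> I \<Longrightarrow> a i \<in> Rn n) \<Longrightarrow> coord_map I f a z \<in> Rn n"
  unfolding coord_map_def by (intro subspace_sum subspace_scale subspace_Rn)

lemma affine_map_between_linear:
  assumes "linear L" "\<And>x. L x \<in> Rn n" shows "affine_map_between m n L"
proof -
  have "L = (\<lambda>x. L x + 0)" by simp
  then show ?thesis
    unfolding affine_map_between_def using assms by blast
qed

text \<open>Each of two coordinate maps kills the unit vectors of the other side, so their sum has
  the prescribed values. It maps every vector into \<open>Rn n\<close>, hence \<open>m\<close> is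
  arbitrary.\<close>

lemma ex_biclique_map:
  assumes fin: "finite I" "finite J" and inj: "inj_on f I" "inj_on g J" and disj: "f ` I \<inter> g ` J = {}"
    and ab: "a ` I \<subseteq> Rn n" "b ` J \<subseteq> Rn n"
  obtains L where "linear L" "affine_map_between m n L"
    "\<And>i. i \<in> I \<Longrightarrow> L (unit_vec (f i)) = a i" "\<And>j. j \<in> J \<Longrightarrow> L (unit_vec (g j)) = b j"
proof
  let ?L = "\<lambda>z. coord_map I f a z + coord_map J g b z"
  show lin: "linear ?L"
    by (intro linear_compose_add linear_coord_map)
  show "affine_map_between m n ?L"
    using ab by (intro affine_map_between_linear lin subspace_add subspace_Rn coord_map_in_Rn) auto
  show "?L (unit_vec (f i)) = a i" if "i \<in> I" for i
  proof -
    have "f i \<notin> g ` J" using that disj by blast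
    then show ?thesis
      using that fin inj by (simp add: coord_map_unit_vec coord_map_unit_vec_notin)
  qed
  show "?L (unit_vec (g j)) = b j" if "j \<in> J" for j
  proof -
    have "g j \<notin> f ` I" using that disj by blast
    then show ?thesis
      using that fin inj by (simp add: coord_map_unit_vec coord_map_unit_vec_notin)
  qed
qed

lemma setcompr_pair_image:
  "{h i j | i j. i \<in> I \<and> j \<in> J \<and> R i j} = (\<lambda>p. h (fst p) (snd p)) ` {p \<in> I \<times> J. R (fst p) (snd p)}"
  by force

text \<open>The index sets become consecutive blocks of coordinates, and the section has at most one
  facet per coordinate. Neither \<open>a\<close> nor \<open>b\<close> has to be injective: several
  indices may carry the same vector, which is how vertices get copied.\<close>

lemma has_extension_biclique_union:
  fixes a :: "'a \<Rightarrow> rvec" and b :: "'b \<Rightarrow> rvec"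
  assumes fin: "finite I" "finite J" and ab: "a ` I \<subseteq> Rn n" "b ` J \<subseteq> Rn n"
  shows "\<exists>k \<le> card I + card J. has_extension n (convex hull {a i + b j | i j. i \<in> I \<and> j \<in> J \<and> c i = d j}) k"
proof -
  define N where "N = card I + card J"
  have "\<exists>f. bij_betw f I {1..card I}"
    by (rule finite_same_card_bij) (simp_all add: fin)
  then obtain f where f: "bij_betw f I {1..card I}" ..
  have "\<exists>g. bij_betw g J {card I + 1..N}"
    by (rule finite_same_card_bij) (simp_all add: fin N_def)
  then obtain g where g: "bij_betw g J {card I + 1..N}" ..
  note inj = bij_betw_imp_inj_on[OF f] bij_betw_imp_inj_on[OF g]
  note ran = bij_betw_imp_surj_on[OF f] bij_betw_imp_surj_on[OF g]
  have union: "f ` I \<union> g ` J = {1..N}" and disj: "f ` I \<inter> g ` J = {}"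
    unfolding ran by (auto simp: N_def)
  let ?V = "{unit_vec (f i) + unit_vec (g j) | i j. i \<in> I \<and> j \<in> J \<and> c i = d j}"
  define M where "M = biclique_flow I f c J g d"
  define Q where "Q = nonneg_section N M"
  have Q: "Q = convex hull ?V"
    unfolding Q_def M_def by (rule convex_hull_biclique_vertices[OF fin inj union disj, symmetric])
  define W where "W = {p \<in> I \<times> J. c (fst p) = d (snd p)}"
  have V: "?V = (\<lambda>p. unit_vec (f (fst p)) + unit_vec (g (snd p))) ` W"
    and ab_W: "{a i + b j | i j. i \<in> I \<and> j \<in> J \<and> c i = d j} = (\<lambda>p. a (fst p) + b (snd p)) ` W"
    unfolding W_def
    using setcompr_pair_image[of "\<lambda>i j. unit_vec (f i) + unit_vec (g j)" I J "\<lambda>i j. c i = d j"]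
      setcompr_pair_image[of "\<lambda>i j. a i + b j" I J "\<lambda>i j. c i = d j"] by simp_all
  have "finite W"
    using fin by (simp add: W_def)
  then have "finite ?V"
    unfolding V by simp
  then have "polytope Q"
    unfolding polytope_def Q by blast
  obtain L where L: "linear L" "affine_map_between N n L"
    "\<And>i. i \<in> I \<Longrightarrow> L (unit_vec (f i)) = a i" "\<And>j. j \<in> J \<Longrightarrow> L (unit_vec (g j)) = b j"
    using ex_biclique_map[OF fin inj disj ab] by blast
  have "L ` ?V = {a i + b j | i j. i \<in> I \<and> j \<in> J \<and> c i = d j}"
    unfolding V ab_W image_image
    by (intro image_cong) (auto simp: W_def linear_add[OF L(1)] L(3,4))
  then have image: "convex hull {a i + b j | i j. i \<in> I \<and> j \<in> J \<and> c i = d j} = L ` Q"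
    unfolding Q by (simp add: convex_hull_linear_image[OF L(1)])
  have facets: "{F. is_facet_of F Q} \<subseteq> (\<lambda>i. Q \<inter> vanishing {i}) ` {1..N}"
    unfolding Q_def M_def by (intro facets_nonneg_section affine_biclique_flow)
  then have "finite {F. is_facet_of F Q}"
    by (rule finite_subset) simp
  moreover have "card {F. is_facet_of F Q} \<le> card I + card J"
    using surj_card_le[OF _ facets] by (simp add: N_def)
  moreover have "Q \<subseteq> Rn N"
    by (auto simp: Q_def nonneg_section_def)
  ultimately show ?thesis
    unfolding has_extension_def image using \<open>polytope Q\<close> L(2) by blast
qed

section \<open>Extension complexity of affine images\<close>

lemma xc_le: "has_extension n P k \<Longrightarrow> xc n P \<le> k"
  unfolding xc_def by (rule Least_le)

lemma has_extension_xc: "has_extension n P k \<Longrightarrow> has_extension n P (xc n P)"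
  unfolding xc_def by (rule LeastI)

text \<open>The polytope upstairs stays the same; only the projection is composed with
  \<open>\<pi>\<close>.\<close>

lemma has_extension_affine_image:
  assumes ext: "has_extension N P k" and \<pi>: "affine_map_between N n \<pi>"
  shows "has_extension n (\<pi> ` P) k"
proof -
  obtain m Q \<rho> where Q: "polytope Q" "Q \<subseteq> Rn m" "finite {F. is_facet_of F Q}"
    "card {F. is_facet_of F Q} = k" and \<rho>: "affine_map_between m N \<rho>" and P: "P = \<rho> ` Q"
    using ext unfolding has_extension_def by blast
  obtain L b where L: "linear L" "\<pi> = (\<lambda>x. L x + b)"
    using \<pi> unfolding affine_map_between_def by blast
  obtain L' b' where L': "linear L'" "\<rho> = (\<lambda>x. L' x + b')"
    using \<rho> unfolding affine_map_between_def by blast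
  have "\<pi> \<circ> \<rho> = (\<lambda>x. (L \<circ> L') x + (L b' + b))"
    unfolding L(2) L'(2) by (auto simp: linear_add[OF L(1)])
  moreover have "linear (L \<circ> L')"
    by (rule linear_compose[OF L'(1) L(1)])
  moreover have "(\<pi> \<circ> \<rho>) ` Rn m \<subseteq> Rn n"
    using \<pi> \<rho> unfolding affine_map_between_def image_comp[symmetric] by blast
  ultimately have "affine_map_between m n (\<pi> \<circ> \<rho>)"
    unfolding affine_map_between_def by blast
  then show ?thesis
    unfolding has_extension_def P image_comp using Q by blast
qed

text \<open>A star whose centre carries the vector 0 projects onto the hull of \<open>V\<close>.
  Existence of some extension is what makes the minimum in \<open>xc\<close> attained.\<close>

lemma ex_extension:
  assumes "finite V" "V \<subseteq> Rn n"
  shows "\<exists>k. has_extension n (convex hull V) k"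
proof -
  have "{v + (\<lambda>_. 0) u | v u. v \<in> V \<and> u \<in> {()} \<and> () = ()} = V" by auto
  then show ?thesis
    using has_extension_biclique_union[of V "{()}" "\<lambda>v. v" n "\<lambda>_. 0" "\<lambda>_. ()" "\<lambda>_. ()"] assms
      subspace_0[OF subspace_Rn]
    by auto
qed

lemma xc_linear_image_le:
  assumes V: "finite V" "V \<subseteq> Rn N" and L: "linear L" "affine_map_between N n L"
  shows "xc n (convex hull (L ` V)) \<le> xc N (convex hull V)"
proof -
  obtain k where "has_extension N (convex hull V) k"
    using ex_extension[OF V] by blast
  then have "has_extension n (L ` (convex hull V)) (xc N (convex hull V))"
    by (intro has_extension_affine_image[OF _ L(2)] has_extension_xc)
  then show ?thesis
    by (simp add: convex_hull_linear_image[OF L(1)] xc_le)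
qed

section \<open>Splitting 0/1 vectors into two blocks\<close>

text \<open>The support set is arbitrary because the high block is not an initial segment.\<close>

definition zero_one_on :: "nat set \<Rightarrow> rvec set" where
  "zero_one_on K = {x. Poly_Mapping.keys x \<subseteq> K \<and> (\<forall>i. Poly_Mapping.lookup x i \<in> {0, 1})}"

lemma zero_one_vectors_eq: "zero_one_vectors n = zero_one_on {1..n}"
  unfolding zero_one_vectors_def zero_one_on_def Rn_def by (auto simp: in_keys_iff)

lemma zero_one_on_subset_Rn: "K \<subseteq> {1..n} \<Longrightarrow> zero_one_on K \<subseteq> Rn n"
  unfolding zero_one_on_def Rn_def by auto

lemma inj_on_keys_zero_one_on: "inj_on Poly_Mapping.keys (zero_one_on K)"
proof (rule inj_onI)
  fix x y assume xy: "x \<in> zero_one_on K" "y \<in> zero_one_on K" "Poly_Mapping.keys x = Poly_Mapping.keys y"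
  have "Poly_Mapping.lookup z i = (if i \<in> Poly_Mapping.keys z then 1 else 0)" if "z \<in> zero_one_on K" for z i
    using that by (auto simp: zero_one_on_def in_keys_iff)
  then show "x = y"
    using xy by (intro poly_mapping_eqI) simp
qed

lemma finite_zero_one_on: "finite K \<Longrightarrow> finite (zero_one_on K)"
  by (rule inj_on_finite[OF inj_on_keys_zero_one_on, of _ "Pow K"]) (auto simp: zero_one_on_def)

lemma card_zero_one_on_le: "finite K \<Longrightarrow> card (zero_one_on K) \<le> 2 ^ card K"
  unfolding card_Pow[symmetric]
  by (rule card_inj_on_le[OF inj_on_keys_zero_one_on]) (auto simp: zero_one_on_def)

lemma zero_one_on_split:
  assumes x: "x \<in> zero_one_on (K \<union> K')" and disj: "K \<inter> K' = {}"
  obtains y z where "y \<in> zero_one_on K" "z \<in> zero_one_on K'" "x = y + z"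
proof
  have lookup_sum_unit: "Poly_Mapping.lookup (\<Sum>j\<in>S. unit_vec j) i = (if i \<in> S then 1 else 0)"
    if "finite S" for S i
    using that by (simp add: lookup_sum lookup_unit_vec)
  \<comment> \<open>For a 0/1 vector \<open>x\<close> this is the restriction of \<open>x\<close> to
    the coordinates in \<open>S\<close>.\<close>
  let ?part = "\<lambda>S. \<Sum>j \<in> Poly_Mapping.keys x \<inter> S. unit_vec j"
  show "?part K \<in> zero_one_on K" "?part K' \<in> zero_one_on K'"
    by (auto simp: zero_one_on_def lookup_sum_unit in_keys_iff split: if_splits)
  show "x = ?part K + ?part K'"
  proof (rule poly_mapping_eqI)
    fix i
    have "Poly_Mapping.lookup x i \<in> {0, 1}" "i \<in> Poly_Mapping.keys x \<Longrightarrow> i \<in> K \<union> K'"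
      using x by (auto simp: zero_one_on_def)
    then show "Poly_Mapping.lookup x i = Poly_Mapping.lookup (?part K + ?part K') i"
      using disj by (auto simp: lookup_add lookup_sum_unit in_keys_iff)
  qed
qed

lemma zero_one_vectors_split:
  assumes "x \<in> zero_one_vectors n" "h \<le> n"
  obtains y z where "y \<in> zero_one_on {1..h}" "z \<in> zero_one_on {h + 1..n}" "x = y + z"
proof -
  have "{1..n} = {1..h} \<union> {h + 1..n}" using assms(2) by auto
  then have "x \<in> zero_one_on ({1..h} \<union> {h + 1..n})"
    using assms(1) by (simp add: zero_one_vectors_eq)
  then show thesis
    by (rule zero_one_on_split) (auto intro: that)
qed

section \<open>Bounds for a given block size\<close>

text \<open>The first summand counts low vectors. The second counts copies of high vectors: at most
  \<open>2 ^ (2 ^ k)\<close> neighbourhoods, each with at most \<open>2 ^ k\<close>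
  elements.\<close>

lemma xc_zero_one_le:
  assumes A: "A \<subseteq> zero_one_vectors n" and "k \<le> n"
  shows "xc n (convex hull A) \<le> 2 ^ (n - k) + 2 ^ (2 ^ k) * 2 ^ k"
proof -
  define X where "X = zero_one_on {1..n - k}"
  define Y where "Y = zero_one_on {n - k + 1..n}"
  have fin: "finite X" "finite Y"
    by (simp_all add: X_def Y_def finite_zero_one_on)
  have cX: "card X \<le> 2 ^ (n - k)"
    unfolding X_def using card_zero_one_on_le[of "{1..n - k}"] by simp
  have cY: "card Y \<le> 2 ^ k"
    unfolding Y_def using card_zero_one_on_le[of "{n - k + 1..n}"] assms(2) by simp
  \<comment> \<open>A pair \<open>(S, z)\<close> is the copy of \<open>z\<close> in the biclique of
    colour \<open>S\<close>.\<close>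
  define J where "J = Sigma (Pow Y) (\<lambda>S. S)"
  have finJ: "finite J"
    unfolding J_def using fin(2) by (intro finite_SigmaI) (auto intro: finite_subset)
  have "card J = (\<Sum>S\<in>Pow Y. card S)"
    unfolding J_def using fin(2) by (intro card_SigmaI) (auto intro: finite_subset)
  also have "\<dots> \<le> card (Pow Y) * card Y"
    using sum_bounded_above[of "Pow Y" card "card Y"] fin(2) by (simp add: card_mono)
  also have "\<dots> \<le> 2 ^ (2 ^ k) * 2 ^ k"
    using cY fin(2) by (intro mult_mono) (auto simp: card_Pow)
  finally have cJ: "card J \<le> 2 ^ (2 ^ k) * 2 ^ k" .
  have sub: "X \<subseteq> Rn n" "Y \<subseteq> Rn n"
    unfolding X_def Y_def by (rule zero_one_on_subset_Rn; auto)+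
  have "\<exists>k \<le> card X + card J. has_extension n (convex hull {y + snd p | y p. y \<in> X \<and> p \<in> J \<and> {z \<in> Y. y + z \<in> A} = fst p}) k"
    by (rule has_extension_biclique_union) (use fin finJ sub in \<open>auto simp: J_def\<close>)
  \<comment> \<open>When the colours agree, membership of \<open>z\<close> in \<open>S\<close> says
    exactly that y + z lies in \<open>A\<close>.\<close>
  moreover have "{y + snd p | y p. y \<in> X \<and> p \<in> J \<and> {z \<in> Y. y + z \<in> A} = fst p} = A" (is "?S = A")
  proof
    show "?S \<subseteq> A" by (auto simp: J_def)
    show "A \<subseteq> ?S"
    proof
      fix x assume "x \<in> A"
      then have "x \<in> zero_one_vectors n" using A by blast
      then obtain y z where "y \<in> X" "z \<in> Y" "x = y + z"
        unfolding X_def Y_def by (rule zero_one_vectors_split[OF _ diff_le_self])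
      with \<open>x \<in> A\<close> show "x \<in> ?S"
        by (intro CollectI exI[of _ y] exI[of _ "({z \<in> Y. y + z \<in> A}, z)"]) (auto simp: J_def)
    qed
  qed
  ultimately obtain l where "l \<le> card X + card J" "has_extension n (convex hull A) l"
    by auto
  then show ?thesis
    using xc_le cX cJ by (meson add_mono order_trans)
qed

text \<open>Low vectors are numbered within the first \<open>m\<close> vertices and high vectors
  within the last \<open>m\<close>; leftover vertices are isolated, so the blocks may have different
  sizes. Sending each unit vector back to the vector it numbers maps the edge polytope onto the hull
  of \<open>A\<close>.\<close>

lemma xc_zero_one_le_edge_polytope:
  assumes A: "A \<subseteq> zero_one_vectors n" and h: "h \<le> n" "2 ^ h \<le> m" "2 ^ (n - h) \<le> m"
  obtains E where "balanced_bipartite_graph m E"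
    "xc n (convex hull A) \<le> xc (2 * m) (edge_polytope E)"
proof -
  define X where "X = zero_one_on {1..h}"
  define Y where "Y = zero_one_on {h + 1..n}"
  have fin: "finite X" "finite Y"
    by (simp_all add: X_def Y_def finite_zero_one_on)
  have "card X \<le> card {1..m}"
    using card_zero_one_on_le[of "{1..h}"] h(2) by (simp add: X_def)
  then obtain f where f: "f ` X \<subseteq> {1..m}" "inj_on f X"
    using card_le_inj[OF fin(1)] by blast
  have "card Y \<le> card {m + 1..2 * m}"
    using card_zero_one_on_le[of "{h + 1..n}"] h(3) by (simp add: Y_def)
  then obtain g where g: "g ` Y \<subseteq> {m + 1..2 * m}" "inj_on g Y"
    using card_le_inj[OF fin(2)] by blast
  have disj: "f ` X \<inter> g ` Y = {}"
    using f(1) g(1) by fastforce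
  have fr: "f y \<in> {1..m}" if "y \<in> X" for y using f(1) that by blast
  have gr: "g z \<in> {m + 1..2 * m}" if "z \<in> Y" for z using g(1) that by blast
  have sub: "(\<lambda>y. y) ` X \<subseteq> Rn n" "(\<lambda>z. z) ` Y \<subseteq> Rn n"
    unfolding image_ident X_def Y_def using h(1) by (intro zero_one_on_subset_Rn; auto)+
  obtain L where L: "linear L" "affine_map_between (2 * m) n L"
    "\<And>y. y \<in> X \<Longrightarrow> L (unit_vec (f y)) = y" "\<And>z. z \<in> Y \<Longrightarrow> L (unit_vec (g z)) = z"
    using ex_biclique_map[OF fin f(2) g(2) disj sub] by blast
  define E where "E = {{f y, g z} | y z. y \<in> X \<and> z \<in> Y \<and> y + z \<in> A}"
  let ?V = "{unit_vec i + unit_vec j | i j. i \<noteq> j \<and> {i, j} \<in> E}"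
  have range_E: "e \<subseteq> {1..2 * m} \<and> card e = 2 \<and> (\<exists>u\<in>{1..m}. \<exists>w\<in>{m + 1..2 * m}. e = {u, w})" if in_E: "e \<in> E" for e
  proof -
    obtain y z where e: "e = {f y, g z}" "y \<in> X" "z \<in> Y"
      using in_E unfolding E_def by blast
    have fg: "f y \<in> {1..m}" "g z \<in> {m + 1..2 * m}"
      using fr gr e by blast+
    show ?thesis
    proof (intro conjI)
      show "\<exists>u\<in>{1..m}. \<exists>w\<in>{m + 1..2 * m}. e = {u, w}"
        using fg e(1) by blast
    qed (use fg in \<open>auto simp: e(1)\<close>)
  qed
  have "balanced_bipartite_graph m E"
    unfolding balanced_bipartite_graph_def simple_graph_def
  proof
    have "{1..m} \<union> {m + 1..2 * m} = {1..2 * m}" by auto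
    then show "\<exists>U W. U \<union> W = {1..2 * m} \<and> U \<inter> W = {} \<and> card U = m \<and> card W = m \<and>
        (\<forall>e\<in>E. \<exists>u\<in>U. \<exists>w\<in>W. e = {u, w})"
      using range_E by - (rule exI[of _ "{1..m}"], rule exI[of _ "{m + 1..2 * m}"], auto)
  qed (use range_E in blast)
  moreover have "xc n (convex hull A) \<le> xc (2 * m) (edge_polytope E)"
  proof -
    have V_sub: "?V \<subseteq> (\<lambda>(i, j). unit_vec i + unit_vec j) ` ({1..2 * m} \<times> {1..2 * m})"
      using range_E by fastforce
    have finV: "finite ?V"
      by (rule finite_subset[OF V_sub]) simp
    have V_Rn: "?V \<subseteq> Rn (2 * m)"
      by (rule subset_trans[OF V_sub]) (auto intro!: subspace_add[OF subspace_Rn])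
    have LV: "L ` ?V = A"
    proof
      show "L ` ?V \<subseteq> A"
      proof clarify
        fix i j assume "{i, j} \<in> E"
        then obtain y z where yz: "{i, j} = {f y, g z}" "y \<in> X" "z \<in> Y" "y + z \<in> A"
          unfolding E_def by blast
        \<comment> \<open>An edge is unordered, so \<open>i\<close> may number either the low or the
          high vector.\<close>
        then have "unit_vec i + unit_vec j = unit_vec (f y) + unit_vec (g z)"
          by (auto simp: doubleton_eq_iff add.commute)
        then show "L (unit_vec i + unit_vec j) \<in> A"
          using yz by (simp add: linear_add[OF L(1)] L(3,4))
      qed
      show "A \<subseteq> L ` ?V"
      proof
        fix x assume x: "x \<in> A"
        then have "x \<in> zero_one_vectors n" using A by blast
        then obtain y z where yz: "y \<in> X" "z \<in> Y" "x = y + z"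
          unfolding X_def Y_def by (rule zero_one_vectors_split[OF _ h(1)])
        have "f y \<noteq> g z"
          using disj yz by blast
        then have "unit_vec (f y) + unit_vec (g z) \<in> ?V"
          using x yz unfolding E_def by blast
        moreover have "L (unit_vec (f y) + unit_vec (g z)) = x"
          using yz by (simp add: linear_add[OF L(1)] L(3,4))
        ultimately show "x \<in> L ` ?V" by blast
      qed
    qed
    show ?thesis
      using xc_linear_image_le[OF finV V_Rn L(1,2)] unfolding LV edge_polytope_def .
  qed
  ultimately show thesis by (rule that)
qed

section \<open>Choice of the block size\<close>

text \<open>From l = 3 on, (l + 1)^2 is at most 2 l^2. The factor 2 covers h = 3, where 9 exceeds
  8.\<close>

lemma square_le_two_power: "h ^ 2 \<le> 2 * 2 ^ h" for h :: nat
proof (induction h rule: nat_less_induct)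
  case (1 h)
  show ?case
  proof (cases "h \<le> 3")
    case True
    then consider "h = 0" | "h = 1" | "h = 2" | "h = 3" by linarith
    then show ?thesis by cases simp_all
  next
    case False
    then obtain l where l: "h = Suc l" "3 \<le> l" by (cases h) auto
    have "2 * l + 1 \<le> l * l"
      using mult_right_mono[OF l(2), of l] l(2) by linarith
    then have "h ^ 2 \<le> 2 * l ^ 2"
      by (simp add: l(1) power2_eq_square)
    then show ?thesis using 1 l by fastforce
  qed
qed

lemma xc_zero_one_le_over_n:
  assumes A: "A \<subseteq> zero_one_vectors n" and n: "1 \<le> n"
  shows "real (xc n (convex hull A)) \<le> 20 * (2 ^ n / real n)"
proof -
  \<comment> \<open>With \<open>2 ^ k\<close> at most about n/2, the factor
    \<open>2 ^ (2 ^ k)\<close> stays near 2^(n/2), while \<open>2 ^ k\<close> is still at least n/4.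
    The maximum with 1 matters only for n = 1, where no power of two would fit below
    \<open>n div 2\<close>.\<close>
  define h where "h = max 1 (n div 2)"
  obtain k where k: "2 ^ k \<le> h" "h < 2 ^ Suc k"
    using ex_power_ivl1[of 2 h] by (auto simp: h_def)
  have "h \<le> n" using n by (auto simp: h_def)
  then have "k \<le> n" using k(1) less_exp[of k] by linarith
  have n4: "n \<le> 4 * 2 ^ k" using k(2) by (auto simp: h_def)
  have "2 ^ (n - k) * n \<le> 2 ^ (n - k) * (4 * 2 ^ k)"
    using n4 by (intro mult_left_mono) auto
  also have "\<dots> = 4 * (2 ^ n :: nat)"
    using \<open>k \<le> n\<close> by (simp flip: power_add)
  finally have part1: "2 ^ (n - k) * n \<le> 4 * (2 ^ n :: nat)" .
  have part2: "2 ^ (2 ^ k) * 2 ^ k * n \<le> 16 * (2 ^ n :: nat)"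
  proof (cases "n = 1")
    case True
    then have "h = 1" by (simp add: h_def)
    then have "k = 0" using k(1) less_exp[of k] by linarith
    then show ?thesis using True by simp
  next
    case False
    then have h: "h = n div 2" using n by (auto simp: h_def)
    have "2 ^ (2 ^ k) * 2 ^ k * n \<le> 2 ^ h * h * (2 * h + 1)"
      using k(1) h by (intro mult_mono power_increasing) auto
    also have "\<dots> = 2 ^ h * (2 * h ^ 2 + h)"
      by (simp add: power2_eq_square algebra_simps)
    \<comment> \<open>Absorbing the polynomial factor costs another 2^h, and 2h is at most
      \<open>n\<close>.\<close>
    also have "\<dots> \<le> 2 ^ h * (4 * 2 ^ h + 2 ^ h)"
      using square_le_two_power[of h] less_exp[of h] by (intro mult_left_mono add_mono) auto
    also have "\<dots> = 5 * 2 ^ (2 * h)"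
      by (simp add: mult_2 power_add)
    also have "\<dots> \<le> 16 * 2 ^ n"
      using h by (intro mult_mono power_increasing) auto
    finally show ?thesis .
  qed
  have "xc n (convex hull A) * n \<le> (2 ^ (n - k) + 2 ^ (2 ^ k) * 2 ^ k) * n"
    using xc_zero_one_le[OF A \<open>k \<le> n\<close>] by (rule mult_right_mono) simp
  also have "\<dots> \<le> 20 * 2 ^ n"
    using part1 part2 by (simp add: distrib_right)
  finally have "real (xc n (convex hull A) * n) \<le> real (20 * 2 ^ n)"
    by (rule of_nat_mono)
  then show ?thesis
    using n by (simp add: field_simps)
qed

text \<open>Halving the coordinates, with the larger block of size n/2 rounded up, gives m^c =
  2^(cn/2) up to a factor 2^(c/2) for odd \<open>n\<close>.\<close>

lemma xc_zero_one_le_of_edge_polytope_bound: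
  fixes c K :: real
  assumes K: "\<And>m E. 1 \<le> m \<Longrightarrow> balanced_bipartite_graph m E \<Longrightarrow>
      real (xc (2 * m) (edge_polytope E)) \<le> K * real m powr c"
    and A: "A \<subseteq> zero_one_vectors n"
  shows "real (xc n (convex hull A)) \<le> \<bar>K\<bar> * max 1 (2 powr (c / 2)) * 2 powr (c * real n / 2)"
proof -
  define h where "h = n div 2"
  define m where "m = (2::nat) ^ (n - h)"
  have "h \<le> n" "h \<le> n - h" by (auto simp: h_def)
  then obtain E where E: "balanced_bipartite_graph m E"
    "xc n (convex hull A) \<le> xc (2 * m) (edge_polytope E)"
    using xc_zero_one_le_edge_polytope[OF A, of h m] by (auto simp: m_def)
  have exponent: "real (n - h) = real n / 2 \<or> real (n - h) = real n / 2 + 1 / 2"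
    unfolding h_def by (cases "even n") (auto elim!: evenE oddE simp: field_simps)
  have "real (xc n (convex hull A)) \<le> K * real m powr c"
    using K[OF _ E(1)] E(2) by (simp add: m_def)
  \<comment> \<open>The sign of \<open>K\<close> is not known, and the following estimates of the
    power are multiplied by it.\<close>
  also have "\<dots> \<le> \<bar>K\<bar> * real m powr c"
    by (intro mult_right_mono) auto
  also have "real m powr c = 2 powr (c * real (n - h))"
    by (simp add: m_def powr_powr mult.commute flip: powr_realpow)
  \<comment> \<open>The maximum with 1 serves even \<open>n\<close>, since 2^(c/2) is below 1 for
    negative \<open>c\<close>.\<close>
  also have "\<dots> \<le> max 1 (2 powr (c / 2)) * 2 powr (c * real n / 2)"
    using exponent
  proof
    assume "real (n - h) = real n / 2"
    then have "c * real (n - h) = c * real n / 2" by (simp only: times_divide_eq_right)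
    then show ?thesis
      using mult_right_mono[of 1 "max 1 (2 powr (c / 2))" "2 powr (c * real n / 2)"] by (simp only: mult_1 max.cobounded1 powr_ge_zero)
  next
    assume "real (n - h) = real n / 2 + 1 / 2"
    then have "2 powr (c * real (n - h)) = 2 powr (c / 2) * 2 powr (c * real n / 2)"
      by (simp add: distrib_left add.commute flip: powr_add)
    then show ?thesis by (simp add: mult_right_mono)
  qed
  finally show ?thesis
    by (simp add: mult.assoc mult_left_mono)
qed

text \<open>The constants found are 20 and \<bar>K\<bar> max(1, 2^(c/2)), so both are independent of
  \<open>n\<close> and \<open>A\<close>.\<close>

theorem proposition7:
  shows "(\<exists>C::real. \<forall>n\<ge>1. \<forall>A. A \<subseteq> zero_one_vectors n \<longrightarrow>
            real (xc n (convex hull A)) \<le> C * (2 ^ n / real n))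
    \<and> (\<forall>c::real. c \<le> 2 \<longrightarrow>
          (\<exists>K::real. \<forall>m\<ge>1. \<forall>E. balanced_bipartite_graph m E \<longrightarrow>
             real (xc (2 * m) (edge_polytope E)) \<le> K * real m powr c) \<longrightarrow>
          (\<exists>C::real. \<forall>n. \<forall>A. A \<subseteq> zero_one_vectors n \<longrightarrow>
             real (xc n (convex hull A)) \<le> C * 2 powr (c * real n / 2)))"
proof (intro conjI allI impI)
  show "\<exists>C::real. \<forall>n\<ge>1. \<forall>A. A \<subseteq> zero_one_vectors n \<longrightarrow>
      real (xc n (convex hull A)) \<le> C * (2 ^ n / real n)"
    using xc_zero_one_le_over_n by blast
next
  fix c :: real
  assume "\<exists>K::real. \<forall>m\<ge>1. \<forall>E. balanced_bipartite_graph m E \<longrightarrow>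
      real (xc (2 * m) (edge_polytope E)) \<le> K * real m powr c"
  then obtain K where "\<And>m E. 1 \<le> m \<Longrightarrow> balanced_bipartite_graph m E \<Longrightarrow>
      real (xc (2 * m) (edge_polytope E)) \<le> K * real m powr c"
    by blast
  from xc_zero_one_le_of_edge_polytope_bound[OF this]
  show "\<exists>C::real. \<forall>n. \<forall>A. A \<subseteq> zero_one_vectors n \<longrightarrow>
      real (xc n (convex hull A)) \<le> C * 2 powr (c * real n / 2)"
    by blast
qed

end
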